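(* If $x\in\mathbb{R}\setminus\mathcal{S}$, then $w(x)$ verifies the following properties: $$\phi(w(x))=x,\qquad\phi'(w(x))>0,\qquad w(x)\,\frac1M\mathrm{Tr}\,R\left(R-w(x)I\right)^{-1}<0 .$$
   Context: $M,N,L\ge1$ are integers, $c=ML/N$, and $R$ is an $M\times M$ Hermitian matrix with $aI_M\le R<bI_M$, $0<a<b$. For $z\in\mathbb{C}^+$ (open upper half plane), $t(z)$ is the unique solution with $t(z)\in\mathbb{C}^+$, $zt(z)\in\mathbb{C}^+$ of $t(z)=\frac1M\mathrm{Tr}\,R\left(-zI_M-\frac{zct(z)}{1-zc^2t(z)^2}R\right)^{-1}$. $t$ is the Stieltjes transform $\int\frac{d\mu(\lambda)}{\lambda-z}$ of a positive finite measure $\mu$ carried by $[0,\infty)$, with support $\mathcal{S}$, and is extended analytically to $\mathbb{C}\setminus\mathcal{S}$. One sets $$w(z)=zct(z)-\frac1{ct(z)},$$ which is analytic on $\mathbb{C}\setminus\mathcal{S}$, and $$\phi(w)=cw^2\,\tfrac1M\mathrm{Tr}R(R-wI)^{-1}\left(c\,\tfrac1M\mathrm{Tr}R(R-wI)^{-1}-1\right).$$ *)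

theory Defs
  imports "HOL-Analysis.Analysis"
begin

text \<open>
  Complex numbers carry the partial order of \<open>HOL-Library.Complex_Order\<close>:
  \<open>u < v\<close> means that \<open>u\<close> and \<open>v\<close> have equal imaginary parts and \<open>Re u < Re v\<close>. Hence \<open>0 < u\<close> and
  \<open>u < 0\<close> include the assertion that \<open>u\<close> is real. The dimension \<open>M\<close> is \<open>CARD('m)\<close>.
\<close>

definition quad_form :: "complex^'m^'m \<Rightarrow> complex^'m \<Rightarrow> complex" where
  "quad_form A v = (\<Sum>i\<in>UNIV. \<Sum>j\<in>UNIV. cnj (v $ i) * A $ i $ j * v $ j)"

definition hermitian :: "complex^'m^'m \<Rightarrow> bool" where
  "hermitian A \<longleftrightarrow> (\<forall>i j. A $ i $ j = cnj (A $ j $ i))"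

definition loewner_le :: "complex^'m^'m \<Rightarrow> complex^'m^'m \<Rightarrow> bool" where
  "loewner_le A B \<longleftrightarrow> (\<forall>v. 0 \<le> quad_form (B - A) v)"

definition loewner_less :: "complex^'m^'m \<Rightarrow> complex^'m^'m \<Rightarrow> bool" where
  "loewner_less A B \<longleftrightarrow> (\<forall>v. v \<noteq> 0 \<longrightarrow> 0 < quad_form (B - A) v)"

definition ntrace :: "complex^'m^'m \<Rightarrow> complex" where
  "ntrace A = trace A / of_nat CARD('m)"

text \<open>
  Since \<open>mat k\<close> is the matrix \<open>k I\<close>, the product \<open>mat k ** R\<close> is the scalar multiple \<open>k R\<close>.
  The requirement that \<open>\<tau>\<close> and \<open>z \<tau>\<close> lie in the upper half plane forces
  \<open>1 - z c\<^sup>2 \<tau>\<^sup>2 \<noteq> 0\<close> and, for a Hermitian matrix \<open>R\<close>, the invertibility of the matrix below.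
\<close>

definition canonical_solution :: "real \<Rightarrow> complex^'m^'m \<Rightarrow> complex \<Rightarrow> complex \<Rightarrow> bool" where
  "canonical_solution c R z \<tau> \<longleftrightarrow>
     0 < Im \<tau> \<and> 0 < Im (z * \<tau>) \<and>
     \<tau> = ntrace (R ** matrix_inv
           (mat (- z) - mat (z * of_real c * \<tau> / (1 - z * (of_real c)\<^sup>2 * \<tau>\<^sup>2)) ** R))"

definition measure_support :: "real measure \<Rightarrow> real set" where
  "measure_support \<mu> = {x. \<forall>U. open U \<longrightarrow> x \<in> U \<longrightarrow> 0 < emeasure \<mu> U}"

definition stieltjes :: "real measure \<Rightarrow> complex \<Rightarrow> complex" where
  "stieltjes \<mu> z = (\<integral>s. 1 / (complex_of_real s - z) \<partial>\<mu>)"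

definition w_fun :: "real \<Rightarrow> (complex \<Rightarrow> complex) \<Rightarrow> complex \<Rightarrow> complex" where
  "w_fun c t z = z * of_real c * t z - 1 / (of_real c * t z)"

definition resolvent_trace :: "complex^'m^'m \<Rightarrow> complex \<Rightarrow> complex" where
  "resolvent_trace R w = ntrace (R ** matrix_inv (R - mat w))"

definition phi :: "real \<Rightarrow> complex^'m^'m \<Rightarrow> complex \<Rightarrow> complex" where
  "phi c R w = of_real c * w\<^sup>2 * resolvent_trace R w * (of_real c * resolvent_trace R w - 1)"

end

theory Submission
  imports Defs
begin

text \<open>
  Put \<open>g(w) = w \<cdot> 1/M \<cdot> Tr R(R - w)\<^bsup>-1\<^esup>\<close>. In the variable \<open>w\<close> the equation for \<open>t\<close> becomes \<open>z t(z) = g(w(z))\<close>,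
  and with the definition of \<open>w\<close> this yields \<open>z = c g(w) (c g(w) - w) = \<phi>(w)\<close>: on the upper half plane
  \<open>\<phi>\<close> is a left inverse of \<open>w\<close> (lemma \<open>canonical_solution_preimage\<close>). Diagonalizing \<open>R\<close> turns \<open>g\<close> into the
  average of \<open>\<lambda> w / (\<lambda> - w)\<close> over the eigenvalues \<open>\<lambda>\<close> (lemma \<open>resolvent_trace_spectral\<close>). With \<open>A(w)\<close> the
  average of \<open>\<lambda>\<^sup>2 / \<bar>\<lambda> - w\<bar>\<^sup>2\<close>, the imaginary part of \<open>g(w)\<close> is \<open>A(w) Im w\<close>, and taking imaginary parts in the
  definition of \<open>w\<close> shows \<open>Im w(z) > 0\<close> and \<open>c A(w(z)) < 1\<close>.

  Now let \<open>z\<close> tend vertically to a real point \<open>x\<close> outside the support. There \<open>t(x)\<close> is real, and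
  nonnegative if \<open>x \<le> 0\<close> (lemma \<open>stieltjes_boundary_value\<close>). The limits of the relations above show that
  \<open>t(x) \<noteq> 0\<close>, that \<open>w(x)\<close> is not an eigenvalue of \<open>R\<close>, that \<open>\<phi>(w(x)) = x\<close>, and that \<open>\<phi>'(w(x)) w'(x) = 1\<close>. As \<open>w\<close> maps the
  upper half plane into itself, \<open>w'(x)\<close> cannot be negative, so \<open>\<phi>'(w(x)) > 0\<close>. The sign of \<open>g(w(x))\<close>
  is elementary for \<open>x \<le> 0\<close>. For \<open>x > 0\<close> a positive value would force \<open>w(x) > 0\<close>, and then the inequality
  \<open>g(w) \<le> w A(w)\<close> for positive \<open>w\<close> together with \<open>c A \<le> 1\<close> would give \<open>\<phi>'(w(x)) \<le> 0\<close>. All of this is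
  lemma \<open>real_boundary_point\<close>.

  The spectral theorem is proved over the reals, for self-adjoint operators of a Euclidean space, and
  applied to \<open>complex^'m\<close> as a real space of dimension \<open>2 M\<close>.
\<close>

section \<open>The spectral theorem over the reals\<close>

text \<open>
  A maximiser \<open>e\<close> of the Rayleigh quotient on the unit sphere of \<open>S\<close> is an eigenvector, and its
  orthogonal complement in \<open>S\<close> is again invariant, so induction on the dimension applies.
  The subspace \<open>S\<close> is in the statement for the sake of this induction.
\<close>

lemma selfadjoint_orthonormal_eigenbasis:
  fixes f :: "'a::euclidean_space \<Rightarrow> 'a"
  assumes f: "linear f" and sa: "\<And>u v. f u \<bullet> v = u \<bullet> f v"
    and "subspace S" and "f ` S \<subseteq> S"
  shows "\<exists>E. pairwise orthogonal E \<and> span E = S \<and> (\<forall>e\<in>E. norm e = 1 \<and> (\<exists>l. f e = l *\<^sub>R e))"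
  using assms(3,4)
proof (induction "dim S" arbitrary: S rule: less_induct)
  case less
  show ?case
  proof (cases "S = {0}")
    case True
    then show ?thesis by (intro exI[of _ "{}"]) auto
  next
    case False
    have "compact (sphere 0 1 \<inter> S)"
      by (intro compact_Int_closed compact_sphere closed_subspace less.prems)
    moreover obtain v where "v \<in> S" "v \<noteq> 0"
      using False subspace_0[OF less.prems(1)] by auto
    then have "(1 / norm v) *\<^sub>R v \<in> sphere 0 1 \<inter> S"
      using less.prems(1) by (auto simp: subspace_scale)
    then have "sphere 0 1 \<inter> S \<noteq> {}" by blast
    moreover have "continuous_on (sphere 0 1 \<inter> S) (\<lambda>v. v \<bullet> f v)"
      using f by (intro continuous_intros linear_continuous_on) (simp add: linear_linear)
    ultimately obtain e where "e \<in> sphere 0 1 \<inter> S"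
      "\<forall>v\<in>sphere 0 1 \<inter> S. v \<bullet> f v \<le> e \<bullet> f e"
      using continuous_attains_sup[of "sphere 0 1 \<inter> S" "\<lambda>v. v \<bullet> f v"] by blast
    then have e: "norm e = 1" "e \<in> S"
      and emax: "\<And>v. v \<in> S \<Longrightarrow> norm v = 1 \<Longrightarrow> v \<bullet> f v \<le> e \<bullet> f e"
      by auto
    define l where "l = e \<bullet> f e"
    \<comment> \<open>\<open>q\<close> is nonnegative and vanishes at \<open>e\<close>. Its first variation at \<open>e\<close> in the direction
        \<open>g = f e - l e\<close> is \<open>- 2 (g \<bullet> g)\<close>, so \<open>g = 0\<close>.\<close>
    define q where "q v = l * (v \<bullet> v) - v \<bullet> f v" for v
    have q0: "0 \<le> q v" if "v \<in> S" for v
    proof (cases "v = 0")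
      case False
      have "((1 / norm v) *\<^sub>R v) \<bullet> f ((1 / norm v) *\<^sub>R v) \<le> l"
        unfolding l_def using False that less.prems(1) by (intro emax) (auto simp: subspace_scale)
      then have "v \<bullet> f v / (norm v)\<^sup>2 \<le> l"
        by (simp add: linear_scale[OF f] power2_eq_square)
      then show ?thesis using False
        by (simp add: q_def power2_norm_eq_inner pos_divide_le_eq)
    qed (simp add: q_def)
    define g where "g = f e - l *\<^sub>R e"
    have gS: "g \<in> S" using e less.prems by (auto simp: g_def subspace_diff subspace_scale)
    have ee: "e \<bullet> e = 1" using e by (simp add: dot_square_norm)
    have exp: "q (e + s *\<^sub>R g) = - 2 * s * (g \<bullet> g) + s\<^sup>2 * q g" for s
    proof -
      have 1: "e \<bullet> f g = g \<bullet> f e" using sa[of e g] by (simp add: inner_commute)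
      have "g \<bullet> g = g \<bullet> f e - l * (e \<bullet> g)"
        by (subst (2) g_def) (simp add: inner_diff inner_commute)
      then have 2: "g \<bullet> f e = g \<bullet> g + l * (e \<bullet> g)" by simp
      show ?thesis
        by (simp add: q_def linear_add[OF f] linear_scale[OF f] inner_add ee l_def[symmetric]
             inner_commute[of g e] 1 2 algebra_simps power2_eq_square)
    qed
    have "2 * (g \<bullet> g) \<le> s * q g" if "0 < s" for s
    proof -
      have "0 \<le> q (e + s *\<^sub>R g)"
        using e gS less.prems(1) by (intro q0) (auto simp: subspace_add subspace_scale)
      then have "s * (2 * (g \<bullet> g)) \<le> s * (s * q g)"
        unfolding exp by (simp add: power2_eq_square algebra_simps)
      then show ?thesis using that by simp
    qed
    note * = this
    have "g \<bullet> g = 0"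
    proof (rule ccontr)
      assume "g \<bullet> g \<noteq> 0"
      then have p: "0 < g \<bullet> g" using inner_ge_zero[of g] by linarith
      have "q g > 0" using *[of 1] p by linarith
      then show False using *[of "(g \<bullet> g) / q g"] p by simp
    qed
    then have fe: "f e = l *\<^sub>R e" by (simp add: g_def)
    define S' where "S' = {v \<in> S. v \<bullet> e = 0}"
    have S': "subspace S'"
      using less.prems(1) by (auto simp: S'_def subspace_def inner_add)
    have fS': "f ` S' \<subseteq> S'"
      using less.prems(2) by (auto simp: S'_def sa fe)
    have "e \<notin> S'" using ee by (simp add: S'_def)
    then have "S' \<subset> S" using e(2) unfolding S'_def by blast
    then have "dim S' < dim S"
      using S' less.prems(1) by (intro dim_psubset) (simp add: span_eq_iff[THEN iffD2])
    from less.hyps[OF this S' fS'] obtain E where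
      E: "pairwise orthogonal E" "span E = S'" "\<forall>e\<in>E. norm e = 1 \<and> (\<exists>l. f e = l *\<^sub>R e)" by blast
    have ES': "E \<subseteq> S'" using E(2) span_superset by blast
    have "span (insert e E) = S"
    proof
      show "span (insert e E) \<subseteq> S"
        using ES' e less.prems(1) by (intro span_minimal) (auto simp: S'_def)
      show "S \<subseteq> span (insert e E)"
      proof
        fix v assume "v \<in> S"
        then have "v - (v \<bullet> e) *\<^sub>R e \<in> S'"
          using e less.prems(1) by (auto simp: S'_def inner_diff ee subspace_diff subspace_scale)
        then show "v \<in> span (insert e E)"
          using E(2) by (auto simp: span_insert)
      qed
    qed
    moreover have "pairwise orthogonal (insert e E)"
      using E(1) ES' by (auto simp: pairwise_insert S'_def orthogonal_def inner_commute)
    ultimately show ?thesis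
      using E(3) e fe by (intro exI[of _ "insert e E"]) auto
  qed
qed

section \<open>The trace of the resolvent of a Hermitian matrix\<close>


definition cinner :: "complex^'m \<Rightarrow> complex^'m \<Rightarrow> complex" where
  "cinner u v = (\<Sum>i\<in>UNIV. cnj (u $ i) * v $ i)"

lemma Re_cinner: "Re (cinner u v) = u \<bullet> v"
  by (simp add: cinner_def inner_vec_def inner_complex_def)

lemma cinner_scale_right: "cinner u (k *s v) = k * cinner u v"
  by (simp add: cinner_def sum_distrib_left algebra_simps)

lemma cinner_scale_left: "cinner (k *s u) v = cnj k * cinner u v"
  by (simp add: cinner_def sum_distrib_left algebra_simps)

lemma cinner_self: "cinner v v = of_real ((norm v)\<^sup>2)"
  by (rule complex_eqI) (simp_all only: Re_cinner power2_norm_eq_inner, simp_all add: cinner_def)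

lemma quad_form_cinner: "quad_form A v = cinner v (A *v v)"
  by (simp add: quad_form_def cinner_def matrix_vector_mult_def sum_distrib_left algebra_simps)

lemma hermitian_cinner:
  assumes "hermitian R"
  shows "cinner (R *v u) v = cinner u (R *v v)"
proof -
  have *: "cnj (R $ i $ j) = R $ j $ i" for i j
    using assms by (metis hermitian_def)
  have "cinner (R *v u) v = (\<Sum>i\<in>UNIV. \<Sum>j\<in>UNIV. R $ j $ i * cnj (u $ j) * v $ i)"
    by (simp add: cinner_def matrix_vector_mult_def sum_distrib_right *)
  also have "\<dots> = (\<Sum>j\<in>UNIV. \<Sum>i\<in>UNIV. R $ j $ i * cnj (u $ j) * v $ i)"
    by (rule sum.swap)
  also have "\<dots> = cinner u (R *v v)"
    by (simp add: cinner_def matrix_vector_mult_def sum_distrib_left algebra_simps)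
  finally show ?thesis .
qed

lemma matrix_vector_mult_complex_linear: "linear ((*v) (A :: complex^'m^'n))"
  by (intro linearI)
     (auto simp: matrix_vector_mult_def vec_eq_iff algebra_simps sum.distrib scaleR_sum_right)

lemma mat_mult_vec: "mat k *v (v :: complex^'m) = k *s v"
  by (simp add: matrix_vector_mult_def mat_def vec_eq_iff if_distrib if_distribR cong: if_cong)

lemma mat_matrix_mult: "mat k ** (A :: complex^'m^'n) = (\<chi> i j. k * A $ i $ j)"
  by (simp add: matrix_matrix_mult_def mat_def vec_eq_iff if_distrib if_distribR cong: if_cong)

lemma matrix_inv_inverse:
  fixes A :: "complex^'m^'m"
  assumes "invertible A"
  shows "A ** matrix_inv A = mat 1" "matrix_inv A ** A = mat 1"
  using someI_ex[of "\<lambda>B. A ** B = mat 1 \<and> B ** A = mat 1"] assms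
  unfolding matrix_inv_def invertible_def by blast+

lemma matrix_inv_eqI:
  fixes A :: "complex^'m^'m"
  assumes "A ** B = mat 1"
  shows "matrix_inv A = B"
proof -
  have "invertible A" using assms matrix_left_right_inverse invertible_def by blast
  then have "matrix_inv A ** (A ** B) = B"
    by (simp add: matrix_mul_assoc matrix_inv_inverse)
  then show ?thesis by (simp add: assms)
qed

lemma matrix_mult_scale_right: "A ** (mat k ** B) = mat k ** (A ** (B :: complex^'m^'n))"
  by (simp add: mat_matrix_mult)
     (simp add: matrix_matrix_mult_def vec_eq_iff sum_distrib_left algebra_simps)

lemma matrix_inv_scale:
  fixes A :: "complex^'m^'m"
  assumes "invertible A" "k \<noteq> 0"
  shows "matrix_inv (mat k ** A) = mat (1 / k) ** matrix_inv A"
proof (rule matrix_inv_eqI)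
  have "mat k ** A ** (mat (1 / k) ** matrix_inv A) = mat (1 / k) ** (mat k ** A ** matrix_inv A)"
    by (rule matrix_mult_scale_right)
  also have "\<dots> = mat (1 / k) ** (mat k ** (A ** matrix_inv A))"
    by (simp only: matrix_mul_assoc)
  also have "\<dots> = mat 1"
    using assms by (simp add: matrix_inv_inverse mat_matrix_mult) (simp add: mat_def vec_eq_iff)
  finally show "mat k ** A ** (mat (1 / k) ** matrix_inv A) = mat 1" .
qed

text \<open>
  The basis is orthonormal for the real inner product of \<open>complex^'m\<close>, so it has twice as many
  elements as a complex basis; this is the factor \<open>1/2\<close>. Parseval's identity, applied to the real and
  imaginary parts of the coordinates, gives \<open>(\<Sum>e\<in>E. cnj (e $ i) * e $ j) = 2\<close> for \<open>i = j\<close> and \<open>0\<close>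
  otherwise, and the formula follows by expanding the sesquilinear forms.
\<close>

lemma trace_orthonormal_basis:
  fixes A :: "complex^'m^'m"
  assumes "pairwise orthogonal E" "\<And>e. e \<in> E \<Longrightarrow> norm e = 1" "span E = UNIV"
  shows "trace A = (\<Sum>e\<in>E. cinner e (A *v e)) / 2"
proof -
  have "0 \<notin> E" using assms(2) by force
  then have fin: "finite E"
    using pairwise_orthogonal_independent[OF assms(1)] independent_imp_finite by blast
  have parseval: "(\<Sum>e\<in>E. (u \<bullet> e) * (v \<bullet> e)) = u \<bullet> v" for u v :: "complex^'m"
  proof -
    have "u \<bullet> v = (\<Sum>e\<in>E. (u \<bullet> e) *\<^sub>R e) \<bullet> v"
      using orthonormal_basis_expand[OF assms(1,2) _ fin, of u] assms(3) by simp
    also have "\<dots> = (\<Sum>e\<in>E. (u \<bullet> e) * (e \<bullet> v))" by (simp add: inner_sum_left)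
    finally show ?thesis by (simp add: inner_commute[of v])
  qed
  have kron: "(\<Sum>e\<in>E. cnj (e $ i) * e $ j) = (if i = j then 2 else 0)" for i j
  proof -
    have re: "Re (e $ i) = axis i 1 \<bullet> e" "Im (e $ i) = axis i \<i> \<bullet> e" for e :: "complex^'m" and i
      by (simp_all add: inner_axis' inner_complex_def)
    have "(\<Sum>e\<in>E. cnj (e $ i) * e $ j) =
       Complex ((\<Sum>e\<in>E. (axis i 1 \<bullet> e) * (axis j 1 \<bullet> e)) + (\<Sum>e\<in>E. (axis i \<i> \<bullet> e) * (axis j \<i> \<bullet> e)))
         ((\<Sum>e\<in>E. (axis i 1 \<bullet> e) * (axis j \<i> \<bullet> e)) - (\<Sum>e\<in>E. (axis i \<i> \<bullet> e) * (axis j 1 \<bullet> e)))"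
      by (rule complex_eqI) (simp_all add: re[symmetric] sum.distrib sum_subtractf)
    then show ?thesis
      unfolding parseval by (auto simp: inner_axis_axis inner_complex_def complex_eq_iff)
  qed
  have "(\<Sum>e\<in>E. cinner e (A *v e))
      = (\<Sum>i\<in>UNIV. \<Sum>e\<in>E. \<Sum>j\<in>UNIV. A $ i $ j * (cnj (e $ i) * e $ j))"
    unfolding cinner_def matrix_vector_mult_def
    by (subst sum.swap) (simp add: sum_distrib_left algebra_simps)
  also have "\<dots> = (\<Sum>i\<in>UNIV. \<Sum>j\<in>UNIV. \<Sum>e\<in>E. A $ i $ j * (cnj (e $ i) * e $ j))"
    by (rule sum.cong[OF refl], rule sum.swap)
  also have "\<dots> = (\<Sum>i\<in>UNIV. \<Sum>j\<in>UNIV. A $ i $ j * (if i = j then 2 else 0))"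
    by (simp add: sum_distrib_left[symmetric] kron)
  also have "\<dots> = 2 * trace A"
    by (simp add: trace_def sum_distrib_left if_distrib mult.commute cong: if_cong)
  finally show ?thesis by simp
qed

text \<open>
  A Hermitian matrix is self-adjoint for the real inner product, and on a real orthonormal basis \<open>E\<close> of
  eigenvectors the matrix \<open>R (R - w)\<^bsup>-1\<^esup>\<close> acts by the scalars \<open>lam e / (lam e - w)\<close>. Every eigenvalue of \<open>R\<close>
  is counted twice in \<open>E\<close>, which the average over \<open>E\<close> does not notice.
\<close>

lemma resolvent_trace_spectral:
  fixes R :: "complex^'m^'m"
  assumes "hermitian R" "loewner_le (mat (of_real a)) R"
  obtains E :: "(complex^'m) set" and lam where "finite E" "E \<noteq> {}" "\<And>e. e \<in> E \<Longrightarrow> a \<le> lam e"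
    "\<And>w. w \<notin> of_real ` lam ` E \<Longrightarrow> invertible (R - mat w)"
    "\<And>w. w \<notin> of_real ` lam ` E \<Longrightarrow>
       resolvent_trace R w = (\<Sum>e\<in>E. of_real (lam e) / (of_real (lam e) - w)) / of_nat (card E)"
proof -
  have "(R *v u) \<bullet> v = u \<bullet> (R *v v)" for u v
    by (simp add: Re_cinner[symmetric] hermitian_cinner[OF assms(1)])
  from selfadjoint_orthonormal_eigenbasis[OF matrix_vector_mult_complex_linear this, of UNIV]
  obtain E where E: "pairwise orthogonal E" "span E = UNIV"
    "\<forall>e\<in>E. norm e = 1 \<and> (\<exists>l. R *v e = l *\<^sub>R e)" by auto
  have "\<forall>e\<in>E. \<exists>l. R *v e = complex_of_real l *s e"
  proof
    fix e assume "e \<in> E"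
    then obtain l where "R *v e = l *\<^sub>R e" using E(3) by blast
    then have "R *v e = complex_of_real l *s e" by (simp add: vec_eq_iff complex_eq_iff)
    then show "\<exists>l. R *v e = complex_of_real l *s e" ..
  qed
  then obtain lam where lam: "\<And>e. e \<in> E \<Longrightarrow> R *v e = complex_of_real (lam e) *s e"
    by metis
  have n1: "\<And>e. e \<in> E \<Longrightarrow> norm e = 1" using E by blast
  have ind: "independent E"
    using n1 pairwise_orthogonal_independent[OF E(1)] by force
  have fin: "finite E" using ind independent_imp_finite by blast
  have "card E = DIM(complex^'m)"
    using dim_eq_card_independent[OF ind] dim_span[of E] by (simp add: E(2))
  then have cE: "card E = 2 * CARD('m)" by simp
  have shift: "(R - mat w) *v e = (of_real (lam e) - w) *s e" if "e \<in> E" for e w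
    by (simp add: matrix_vector_mult_diff_rdistrib mat_mult_vec lam that)
  have inv: "invertible (R - mat w)" if w: "w \<notin> of_real ` lam ` E" for w
  proof -
    have "v = 0" if v: "(R - mat w) *v v = 0" for v
    proof -
      have Rv: "R *v v = w *s v"
        using v by (simp add: matrix_vector_mult_diff_rdistrib mat_mult_vec)
      \<comment> \<open>Orthogonality for the real inner product says nothing about complex multiples of \<open>e\<close>, so
          the sesquilinear form is needed to compare the complex eigenvalue \<open>w\<close> with \<open>lam e\<close>.\<close>
      have "v \<bullet> e = 0" if "e \<in> E" for e
      proof -
        have "of_real (lam e) * cinner e v = w * cinner e v"
          using hermitian_cinner[OF assms(1), of e v] that
          by (simp add: lam Rv cinner_scale_left cinner_scale_right)
        moreover have "w \<noteq> of_real (lam e)" using w that by auto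
        ultimately have "cinner e v = 0" by auto
        then show ?thesis using Re_cinner[of e v] by (simp add: inner_commute)
      qed
      then show "v = 0"
        using orthonormal_basis_expand[OF E(1) n1 _ fin, of v] E(2) by simp
    qed
    then show ?thesis by (auto simp: invertible_left_inverse matrix_left_invertible_ker)
  qed
  have res: "resolvent_trace R w = (\<Sum>e\<in>E. of_real (lam e) / (of_real (lam e) - w)) / of_nat (card E)"
    if w: "w \<notin> of_real ` lam ` E" for w
  proof -
    have *: "cinner e ((R ** matrix_inv (R - mat w)) *v e) = of_real (lam e) / (of_real (lam e) - w)"
      if e: "e \<in> E" for e
    proof -
      have ne: "of_real (lam e) - w \<noteq> 0" using w e by auto
      have "matrix_inv (R - mat w) *v ((of_real (lam e) - w) *s e) = e"
        using matrix_inv_inverse(2)[OF inv[OF w]] shift[OF e, of w] by (metis matrix_vector_mul_assoc matrix_vector_mul_lid)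
      then have "(of_real (lam e) - w) *s (matrix_inv (R - mat w) *v e) = e"
        by (simp only: vector_scalar_commute)
      then have "matrix_inv (R - mat w) *v e = (1 / (of_real (lam e) - w)) *s e"
        using ne by (auto simp: vec_eq_iff field_simps)
      then have "(R ** matrix_inv (R - mat w)) *v e = (of_real (lam e) / (of_real (lam e) - w)) *s e"
        by (simp add: matrix_vector_mul_assoc[symmetric] vector_scalar_commute lam e)
      then show ?thesis by (simp add: cinner_scale_right cinner_self n1 e)
    qed
    have "trace (R ** matrix_inv (R - mat w)) = (\<Sum>e\<in>E. of_real (lam e) / (of_real (lam e) - w)) / 2"
      using trace_orthonormal_basis[OF E(1) n1 E(2), of "R ** matrix_inv (R - mat w)"] * by simp
    then show ?thesis
      by (simp only: resolvent_trace_def ntrace_def cE) simp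
  qed
  have al: "a \<le> lam e" if "e \<in> E" for e
  proof -
    have "0 \<le> quad_form (R - mat (of_real a)) e" using assms(2) by (simp add: loewner_le_def)
    also have "\<dots> = cinner e ((of_real (lam e) - of_real a) *s e)"
      by (simp only: quad_form_cinner shift that)
    also have "\<dots> = of_real (lam e - a)"
      by (simp only: cinner_scale_right cinner_self n1 that) simp
    finally show ?thesis by (simp add: less_eq_complex_def)
  qed
  have "E \<noteq> {}" using cE by auto
  with fin show ?thesis by (rule that[OF _ _ al inv res])
qed

section \<open>The function \<open>w \<cdot> Tr R(R - w)\<^bsup>-1\<^esup>\<close> and its slope\<close>

text \<open>
  This is \<open>w\<close> times the normalized trace of \<open>R (R - w)\<^bsup>-1\<^esup>\<close>, written in terms of the eigenvalues \<open>lam e\<close>.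
  The factor \<open>w\<close> is included because this product is what equals \<open>z t(z)\<close>.
\<close>

definition resolvent_mean :: "'b set \<Rightarrow> ('b \<Rightarrow> real) \<Rightarrow> complex \<Rightarrow> complex" where
  "resolvent_mean E lam w = (\<Sum>e\<in>E. of_real (lam e) * w / (of_real (lam e) - w)) / of_nat (card E)"

text \<open>
  At a real point other than an eigenvalue this is the derivative of \<open>resolvent_mean\<close>. Off the axis it is the ratio of the
  imaginary parts of \<open>resolvent_mean\<close> and of its argument, so one quantity controls both regimes.
\<close>

definition resolvent_slope :: "'b set \<Rightarrow> ('b \<Rightarrow> real) \<Rightarrow> complex \<Rightarrow> real" where
  "resolvent_slope E lam w = (\<Sum>e\<in>E. (lam e)\<^sup>2 / (cmod (of_real (lam e) - w))\<^sup>2) / real (card E)"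

lemma Im_resolvent_mean: "Im (resolvent_mean E lam w) = resolvent_slope E lam w * Im w"
proof -
  have "Im (of_real l * w / (of_real l - w)) = l\<^sup>2 / (cmod (of_real l - w))\<^sup>2 * Im w" for l :: real
    by (simp add: Im_divide cmod_power2) (simp add: power2_eq_square algebra_simps)
  then show ?thesis
    by (simp add: resolvent_mean_def resolvent_slope_def Im_divide_of_nat sum_distrib_right)
qed

lemma resolvent_mean_of_real:
  "resolvent_mean E lam (of_real w) = of_real ((\<Sum>e\<in>E. lam e * w / (lam e - w)) / real (card E))"
  by (simp add: resolvent_mean_def)

lemma resolvent_slope_of_real:
  "resolvent_slope E lam (of_real w) = (\<Sum>e\<in>E. (lam e)\<^sup>2 / (lam e - w)\<^sup>2) / real (card E)"
  by (simp add: resolvent_slope_def flip: of_real_diff)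

lemma resolvent_mean_has_field_derivative:
  assumes "w \<notin> lam ` E"
  shows "(resolvent_mean E lam has_field_derivative of_real (resolvent_slope E lam (of_real w))) (at (of_real w))"
proof -
  have d: "((\<lambda>w. of_real l * w / (of_real l - w)) has_field_derivative of_real (l\<^sup>2 / (l - w)\<^sup>2))
      (at (complex_of_real w))" if "l \<noteq> w" for l
    using that by (auto intro!: derivative_eq_intros simp: power2_eq_square algebra_simps)
  have "((\<lambda>w. (\<Sum>e\<in>E. of_real (lam e) * w / (of_real (lam e) - w)) / of_nat (card E))
      has_field_derivative (\<Sum>e\<in>E. of_real ((lam e)\<^sup>2 / (lam e - w)\<^sup>2)) / of_nat (card E))
      (at (complex_of_real w))"
    using assms by (intro DERIV_cdivide DERIV_sum d) auto
  then show ?thesis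
    unfolding resolvent_mean_def[abs_def] resolvent_slope_of_real by simp
qed

lemma resolvent_mean_negative:
  assumes "finite E" "E \<noteq> {}" "\<And>e. e \<in> E \<Longrightarrow> 0 < lam e" "w < 0"
  shows "Re (resolvent_mean E lam (of_real w)) < 0"
proof -
  have "lam e * w / (lam e - w) < 0" if "e \<in> E" for e
    using assms(3)[OF that] assms(4) by (intro divide_neg_pos mult_pos_neg) auto
  then have "(\<Sum>e\<in>E. lam e * w / (lam e - w)) < (\<Sum>e\<in>E. 0)"
    using assms by (intro sum_strict_mono) auto
  then show ?thesis
    using assms by (simp add: resolvent_mean_of_real divide_neg_pos card_gt_0_iff del: of_real_sum of_real_divide)
qed

text \<open>
  Put \<open>u = l / (l - w)\<close>. If \<open>l\<close> and \<open>w\<close> are positive, then \<open>u < 0\<close> or \<open>u > 1\<close>, hence \<open>u \<le> u\<^sup>2\<close>;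
  multiply by \<open>w\<close> and average over the eigenvalues \<open>l\<close>.
\<close>

lemma resolvent_mean_le_slope:
  assumes "\<And>e. e \<in> E \<Longrightarrow> 0 < lam e" "0 < w" "w \<notin> lam ` E"
  shows "Re (resolvent_mean E lam (of_real w)) \<le> w * resolvent_slope E lam (of_real w)"
proof -
  have "l * w / (l - w) \<le> w * (l\<^sup>2 / (l - w)\<^sup>2)" if "0 < l" "l \<noteq> w" for l
  proof -
    have "w * (l\<^sup>2 / (l - w)\<^sup>2) - l * w / (l - w) = l * w\<^sup>2 / (l - w)\<^sup>2"
      using that by (simp add: divide_simps) (simp add: algebra_simps power2_eq_square)
    also have "\<dots> \<ge> 0" using that by simp
    finally show ?thesis by simp
  qed
  then have "(\<Sum>e\<in>E. lam e * w / (lam e - w)) \<le> (\<Sum>e\<in>E. w * ((lam e)\<^sup>2 / (lam e - w)\<^sup>2))"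
    using assms by (intro sum_mono) auto
  then have "(\<Sum>e\<in>E. lam e * w / (lam e - w)) / real (card E)
      \<le> w * (\<Sum>e\<in>E. (lam e)\<^sup>2 / (lam e - w)\<^sup>2) / real (card E)"
    by (intro divide_right_mono) (auto simp: sum_distrib_left)
  then show ?thesis by (simp only: resolvent_mean_of_real resolvent_slope_of_real Re_complex_of_real times_divide_eq_right)
qed

lemma resolvent_mean_at_infinity:
  "(resolvent_mean E lam \<longlongrightarrow> of_real (- (\<Sum>e\<in>E. lam e) / real (card E))) at_infinity"
proof -
  have l: "((\<lambda>w. complex_of_real l * w / (of_real l - w)) \<longlongrightarrow> - of_real l) at_infinity" for l :: real
  proof -
    have "((\<lambda>w::complex. of_real l / (of_real l * inverse w - 1)) \<longlongrightarrow> of_real l / (of_real l * 0 - 1))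
        at_infinity"
      by (intro tendsto_intros tendsto_inverse_0) auto
    moreover have "\<forall>\<^sub>F w::complex in at_infinity. of_real l / (of_real l * inverse w - 1) =
        of_real l * w / (of_real l - w)"
      unfolding eventually_at_infinity
      by (intro exI[of _ 1]) (auto simp: divide_simps)
    ultimately show ?thesis by (auto dest: Lim_transform_eventually)
  qed
  have "(resolvent_mean E lam \<longlongrightarrow> (\<Sum>e\<in>E. - of_real (lam e)) / of_nat (card E)) at_infinity"
    unfolding resolvent_mean_def[abs_def] divide_inverse[of _ "of_nat _"] by (intro tendsto_intros l)
  then show ?thesis by (simp add: sum_negf)
qed

text \<open>
  A bound on the slope keeps \<open>w\<close> away from the eigenvalues.
\<close>

lemma resolvent_slope_term_le:
  assumes "finite E" "e \<in> E"
  shows "(lam e)\<^sup>2 / (cmod (of_real (lam e) - w))\<^sup>2 \<le> real (card E) * resolvent_slope E lam w"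
proof -
  have "(lam e)\<^sup>2 / (cmod (of_real (lam e) - w))\<^sup>2
      \<le> (\<Sum>e\<in>E. (lam e)\<^sup>2 / (cmod (of_real (lam e) - w))\<^sup>2)"
    using assms by (intro member_le_sum) auto
  also have "\<dots> = real (card E) * resolvent_slope E lam w"
    using assms by (auto simp: resolvent_slope_def card_eq_0_iff)
  finally show ?thesis .
qed

section \<open>The fixed point equation in the variable \<open>w\<close>\<close>

text \<open>
  The definition of \<open>w\<close> makes the coefficient of \<open>R\<close> in the fixed point equation equal to \<open>z / w\<close>. The
  matrix to invert is then \<open>(z / w) (R - w)\<close>, and the equation reads \<open>z \<tau> = resolvent_mean w\<close>. Since
  \<open>c (z \<tau>) - w = 1 / (c \<tau>)\<close>, multiplying by \<open>c (z \<tau>)\<close> gives \<open>z\<close> back. For the slope, compare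
  imaginary parts: \<open>Im w = c Im (z \<tau>) + Im \<tau> / (c \<bar>\<tau>\<bar>\<^sup>2)\<close> exceeds \<open>c Im (z \<tau>)\<close>, which is \<open>c\<close> times the slope
  times \<open>Im w\<close>.
\<close>

lemma canonical_solution_preimage:
  fixes R :: "complex^'m^'m"
  assumes c: "0 < c" and z: "0 < Im z" and can: "canonical_solution c R z \<tau>"
    and w_def: "w = z * of_real c * \<tau> - 1 / (of_real c * \<tau>)"
    and inv: "\<And>w. w \<notin> of_real ` lam ` E \<Longrightarrow> invertible (R - mat w)"
    and rt: "\<And>w. w \<notin> of_real ` lam ` E \<Longrightarrow> w * resolvent_trace R w = resolvent_mean E lam w"
  shows "0 < Im w" "z * \<tau> = resolvent_mean E lam w"
    "of_real c * resolvent_mean E lam w * (of_real c * resolvent_mean E lam w - w) = z"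
    "c * resolvent_slope E lam w < 1"
proof -
  have im: "0 < Im \<tau>" "0 < Im (z * \<tau>)"
    and fixpoint: "\<tau> = ntrace (R ** matrix_inv
           (mat (- z) - mat (z * of_real c * \<tau> / (1 - z * (of_real c)\<^sup>2 * \<tau>\<^sup>2)) ** R))"
    using can by (simp_all add: canonical_solution_def)
  have nz: "\<tau> \<noteq> 0" "z \<noteq> 0" using im by auto
  have imd: "Im (- (1 / (of_real c * \<tau>))) = Im \<tau> / (c * (cmod \<tau>)\<^sup>2)"
  proof -
    have "- (1 / (of_real c * \<tau>)) = of_real (- 1 / c) * inverse \<tau>"
      using c nz by (simp add: field_simps)
    also have "Im \<dots> = - 1 / c * Im (inverse \<tau>)" by simp
    finally show ?thesis by (simp add: cmod_power2)
  qed
  have imw: "Im w = c * Im (z * \<tau>) + Im \<tau> / (c * (cmod \<tau>)\<^sup>2)"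
    using imd by (simp add: w_def algebra_simps)
  have p: "0 < Im \<tau> / (c * (cmod \<tau>)\<^sup>2)" using im c nz by simp
  have cp: "0 < c * Im (z * \<tau>)" using c im by simp
  show pos: "0 < Im w" unfolding imw using p cp by linarith
  then have w: "w \<notin> of_real ` lam ` E" "w \<noteq> 0" by auto
  have wct: "w * (of_real c * \<tau>) = z * (of_real c)\<^sup>2 * \<tau>\<^sup>2 - 1"
    using c nz by (simp add: w_def field_simps power2_eq_square)
  have coef: "z * of_real c * \<tau> / (1 - z * (of_real c)\<^sup>2 * \<tau>\<^sup>2) = - (z / w)"
  proof -
    have den: "1 - z * (of_real c)\<^sup>2 * \<tau>\<^sup>2 = - (w * (of_real c * \<tau>))" by (simp add: wct)
    show ?thesis unfolding den using c nz w by (simp add: field_simps)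
  qed
  have "mat (- z) - mat (- (z / w)) ** R = mat (z / w) ** (R - mat w)"
    using w by (simp add: mat_matrix_mult) (simp add: mat_def vec_eq_iff diff_divide_distrib algebra_simps)
  then have "\<tau> = ntrace (R ** (mat (w / z) ** matrix_inv (R - mat w)))"
    using fixpoint matrix_inv_scale[OF inv[OF w(1)], of "z / w"] w nz by (simp add: coef)
  also have "\<dots> = w / z * resolvent_trace R w"
    unfolding matrix_mult_scale_right ntrace_def resolvent_trace_def
    by (simp add: mat_matrix_mult trace_def sum_distrib_left)
  finally show zt: "z * \<tau> = resolvent_mean E lam w"
    using rt[OF w(1)] nz by (simp add: field_simps)
  have diff: "of_real c * (z * \<tau>) - w = 1 / (of_real c * \<tau>)"
    by (simp add: w_def algebra_simps)
  show "of_real c * resolvent_mean E lam w * (of_real c * resolvent_mean E lam w - w) = z"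
    unfolding zt[symmetric] diff using nz c by simp
  have "Im (z * \<tau>) = resolvent_slope E lam w * Im w" by (simp add: zt Im_resolvent_mean)
  then have "c * resolvent_slope E lam w * Im w < 1 * Im w"
    using imw p by (simp add: mult.assoc)
  then show "c * resolvent_slope E lam w < 1" using pos by (simp only: mult_less_cancel_right_pos)
qed

section \<open>Passage to the real axis\<close>


lemma sequence_into_upper_half_plane:
  obtains Z :: "nat \<Rightarrow> complex" where "\<And>n. 0 < Im (Z n)" "\<And>n. Re (Z n) = x"
    "filterlim Z (at (of_real x)) sequentially"
proof
  define Z where "Z n = of_real x + \<i> * of_real (inverse (real (Suc n)))" for n
  show "0 < Im (Z n)" "Re (Z n) = x" for n by (simp_all add: Z_def)
  have "(\<lambda>n. of_real x + \<i> * of_real (inverse (real (Suc n)))) \<longlonglongrightarrow> of_real x + \<i> * of_real 0"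
    by (intro tendsto_intros LIMSEQ_inverse_real_of_nat)
  then have "Z \<longlonglongrightarrow> of_real x" by (simp add: Z_def[abs_def])
  moreover have "Z n \<noteq> of_real x" for n by (auto simp: Z_def complex_eq_iff)
  ultimately show "filterlim Z (at (of_real x)) sequentially"
    by (simp add: filterlim_at)
qed

text \<open>
  The relations on the upper half plane are carried to a real point \<open>x\<close> by
  a vertical sequence \<open>Z n\<close>. Two degenerations have to be excluded. If \<open>t x = 0\<close>, then
  \<open>w (Z n) \<rightarrow> \<infinity>\<close>, so \<open>resolvent_mean (w (Z n))\<close> tends to minus the average eigenvalue, although it equals
  \<open>Z n * t (Z n) \<rightarrow> 0\<close>. If the limit \<open>v\<close> of \<open>w (Z n)\<close> is an eigenvalue, then the slope at \<open>w (Z n)\<close> is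
  unbounded, although it stays below \<open>1 / c\<close>.

  Let \<open>p\<close> be the value and \<open>A\<close> the slope of \<open>resolvent_mean\<close> at \<open>v\<close>, and \<open>D\<close> the derivative at \<open>v\<close> of the
  left inverse \<open>F\<close> of \<open>w\<close>. Then \<open>D\<close> is real, \<open>D w'(x) = 1\<close>, and \<open>Re w'(x) \<ge> 0\<close> because \<open>w\<close> is real at \<open>x\<close> and
  maps the upper half plane into itself; so \<open>D > 0\<close>. The sign of \<open>p = x t(x)\<close> is the last point. If
  \<open>x \<le> 0\<close>, then \<open>t(x) > 0\<close>, so \<open>v < 0\<close> and \<open>p < 0\<close>. If \<open>x > 0\<close> and \<open>t(x) > 0\<close>, then \<open>v > 0\<close> and \<open>p \<le> v A\<close>,
  whence \<open>D = c (2 c A p - v A - p) \<le> 2 c p (c A - 1) \<le> 0\<close>, a contradiction; so \<open>t(x) < 0\<close> and \<open>p < 0\<close>.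
\<close>

lemma real_boundary_point:
  fixes t :: "complex \<Rightarrow> complex" and c :: real
  defines "w \<equiv> \<lambda>z. w_fun c t z"
  assumes E: "finite E" "E \<noteq> {}" and lam: "\<And>e. e \<in> E \<Longrightarrow> 0 < lam e" and c: "0 < c"
    and t: "t field_differentiable at (of_real x)" "t (of_real x) \<in> \<real>"
      "x \<le> 0 \<Longrightarrow> 0 \<le> Re (t (of_real x))"
    and imw: "\<And>z. 0 < Im z \<Longrightarrow> 0 < Im (w z)"
    and zt: "\<And>z. 0 < Im z \<Longrightarrow> z * t z = resolvent_mean E lam (w z)"
    and tnz: "\<And>z. 0 < Im z \<Longrightarrow> t z \<noteq> 0"
    and phi: "\<And>z. 0 < Im z \<Longrightarrow>
      of_real c * resolvent_mean E lam (w z) * (of_real c * resolvent_mean E lam (w z) - w z) = z"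
    and slope: "\<And>z. 0 < Im z \<Longrightarrow> c * resolvent_slope E lam (w z) < 1"
  obtains v D where "w (of_real x) = of_real v" "v \<notin> lam ` E"
    "of_real c * resolvent_mean E lam (of_real v) * (of_real c * resolvent_mean E lam (of_real v) - of_real v) = of_real x"
    "((\<lambda>u. of_real c * resolvent_mean E lam u * (of_real c * resolvent_mean E lam u - u)) has_field_derivative of_real D)
       (at (of_real v))" "0 < D"
    "Re (resolvent_mean E lam (of_real v)) < 0"
proof -
  obtain Z where Z: "\<And>n. 0 < Im (Z n)" "\<And>n. Re (Z n) = x" "filterlim Z (at (complex_of_real x)) sequentially"
    using sequence_into_upper_half_plane[of x] by blast
  have Zx: "Z \<longlonglongrightarrow> of_real x" using Z(3) by (simp add: filterlim_at)
  have "isCont t (of_real x)" using t(1) by (rule field_differentiable_imp_continuous_at)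
  then have tZ: "(\<lambda>n. t (Z n)) \<longlonglongrightarrow> t (of_real x)"
    using Zx by (rule isCont_tendsto_compose)
  obtain T where T: "t (of_real x) = of_real T" using t(2) by (auto elim: Reals_cases)
  have T0: "T \<noteq> 0"
  proof
    assume "T = 0"
    then have t0: "(\<lambda>n. t (Z n)) \<longlonglongrightarrow> 0" using tZ T by simp
    have "(\<lambda>n. of_real c * t (Z n)) \<longlonglongrightarrow> of_real c * 0" by (intro tendsto_intros t0)
    then have "filterlim (\<lambda>n. of_real c * t (Z n)) (at 0) sequentially"
      using tnz Z(1) c by (auto simp: filterlim_at)
    then have "filterlim (\<lambda>n. inverse (of_real c * t (Z n))) at_infinity sequentially"
      by (rule filterlim_compose[OF filterlim_inverse_at_infinity])
    then have "filterlim (\<lambda>n. - inverse (of_real c * t (Z n))) at_infinity sequentially"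
      by (simp add: filterlim_at_infinity_conv_norm_at_top)
    moreover have "(\<lambda>n. Z n * of_real c * t (Z n)) \<longlonglongrightarrow> of_real x * of_real c * 0"
      by (intro tendsto_intros Zx t0)
    ultimately have "filterlim (\<lambda>n. Z n * of_real c * t (Z n) + - inverse (of_real c * t (Z n)))
        at_infinity sequentially"
      by (intro tendsto_add_filterlim_at_infinity)
    then have "filterlim (\<lambda>n. w (Z n)) at_infinity sequentially"
      by (simp add: w_def w_fun_def divide_inverse)
    then have "(\<lambda>n. resolvent_mean E lam (w (Z n))) \<longlonglongrightarrow> of_real (- (\<Sum>e\<in>E. lam e) / real (card E))"
      by (rule filterlim_compose[OF resolvent_mean_at_infinity])
    moreover have "(\<lambda>n. Z n * t (Z n)) \<longlonglongrightarrow> of_real x * 0" by (intro tendsto_intros Zx t0)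
    then have "(\<lambda>n. resolvent_mean E lam (w (Z n))) \<longlonglongrightarrow> 0" using zt Z(1) by simp
    ultimately have "of_real (- (\<Sum>e\<in>E. lam e) / real (card E)) = (0::complex)"
      by (rule LIMSEQ_unique)
    moreover have "0 < (\<Sum>e\<in>E. lam e)" using E lam by (intro sum_pos)
    ultimately show False using E by (simp del: of_real_sum of_real_divide of_real_minus)
  qed
  define v where "v = x * c * T - 1 / (c * T)"
  have wx: "w (of_real x) = of_real v" by (simp add: w_def w_fun_def v_def T)
  have "w field_differentiable at (of_real x)"
    unfolding w_def w_fun_def[abs_def] using t(1) T T0 c by (intro derivative_intros) auto
  then obtain w' where w': "(w has_field_derivative w') (at (of_real x))"
    by (auto simp: field_differentiable_def)
  have wZ: "(\<lambda>n. w (Z n)) \<longlonglongrightarrow> of_real v"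
    using isCont_tendsto_compose[OF DERIV_isCont[OF w'] Zx] by (simp add: wx)
  have v: "v \<notin> lam ` E"
  proof
    assume "v \<in> lam ` E"
    then obtain e where e: "e \<in> E" "v = lam e" by auto
    have "c * (lam e)\<^sup>2 \<le> real (card E) * (cmod (of_real (lam e) - w (Z n)))\<^sup>2" for n
    proof -
      have "of_real (lam e) \<noteq> w (Z n)"
        using imw[OF Z(1), of n] by (metis Im_complex_of_real less_irrefl)
      then have ne: "cmod (of_real (lam e) - w (Z n)) > 0" by simp
      have "c * ((lam e)\<^sup>2 / (cmod (of_real (lam e) - w (Z n)))\<^sup>2)
          \<le> c * (real (card E) * resolvent_slope E lam (w (Z n)))"
        using c e E(1) by (intro mult_left_mono resolvent_slope_term_le) auto
      also have "\<dots> \<le> real (card E)"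
        using slope[OF Z(1), of n] mult_left_mono[of "c * resolvent_slope E lam (w (Z n))" 1 "real (card E)"]
        by (simp add: mult_ac)
      finally show ?thesis using ne by (simp add: pos_divide_le_eq)
    qed
    moreover have "(\<lambda>n. real (card E) * (cmod (of_real (lam e) - w (Z n)))\<^sup>2)
        \<longlonglongrightarrow> real (card E) * (cmod (of_real (lam e) - of_real v))\<^sup>2"
      by (intro tendsto_intros wZ)
    ultimately have "c * (lam e)\<^sup>2 \<le> real (card E) * (cmod (of_real (lam e) - of_real v))\<^sup>2"
      by (intro LIMSEQ_le_const) auto
    then show False using e lam[OF e(1)] c by (simp add: mult_le_0_iff)
  qed
  define p where "p = Re (resolvent_mean E lam (of_real v))"
  define A where "A = resolvent_slope E lam (of_real v)"
  have mean_v: "resolvent_mean E lam (of_real v) = of_real p"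
    unfolding p_def resolvent_mean_of_real by simp
  have d_mean: "(resolvent_mean E lam has_field_derivative of_real A) (at (of_real v))"
    using resolvent_mean_has_field_derivative[OF v] by (simp add: A_def)
  have mean_Z: "(\<lambda>n. resolvent_mean E lam (w (Z n))) \<longlonglongrightarrow> of_real p"
    using isCont_tendsto_compose[OF DERIV_isCont[OF d_mean] wZ] by (simp add: mean_v)
  have p_eq: "p = x * T"
  proof -
    have "(\<lambda>n. Z n * t (Z n)) \<longlonglongrightarrow> of_real x * of_real T"
      using tZ by (intro tendsto_intros Zx) (simp add: T)
    then have "(\<lambda>n. resolvent_mean E lam (w (Z n))) \<longlonglongrightarrow> of_real x * of_real T" using zt Z(1) by simp
    with mean_Z have "complex_of_real p = of_real x * of_real T" by (rule LIMSEQ_unique)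
    then show ?thesis by (simp flip: of_real_mult)
  qed
  have cpv: "c * p - v = 1 / (c * T)" by (simp add: p_eq v_def)
  have F_v: "c * p * (c * p - v) = x"
    unfolding cpv using T0 c by (simp add: p_eq)
  have cA: "c * A \<le> 1"
  proof -
    have "(\<lambda>n. c * resolvent_slope E lam (w (Z n))) \<longlonglongrightarrow> c * A"
      unfolding resolvent_slope_def A_def divide_inverse[of _ "real _"] using v
      by (intro tendsto_intros wZ) (auto simp flip: of_real_diff)
    then show ?thesis using slope Z(1) by (intro LIMSEQ_le_const2) (auto intro: less_imp_le)
  qed
  define D where "D = c * A * (c * p - v) + c * p * (c * A - 1)"
  define F where "F u = of_real c * resolvent_mean E lam u * (of_real c * resolvent_mean E lam u - u)" for u
  have dF: "(F has_field_derivative of_real D) (at (of_real v))"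
    unfolding F_def[abs_def] D_def
    by (rule derivative_eq_intros d_mean refl)+ (simp add: mean_v algebra_simps)
  have dFw: "((\<lambda>z. F (w z)) has_field_derivative of_real D * w') (at (of_real x))"
    using DERIV_chain2[of F _ w] dF w' wx by simp
  have Fwx: "F (w (of_real x)) = of_real x"
    using arg_cong[OF F_v, of complex_of_real] by (simp add: F_def wx mean_v)
  have "of_real D * w' = 1"
  proof -
    have "(\<lambda>n. (F (w (Z n)) - F (w (of_real x))) / (Z n - of_real x)) \<longlonglongrightarrow> of_real D * w'"
      using dFw Z(3) unfolding has_field_derivative_iff by (rule filterlim_compose)
    moreover have "(F (w (Z n)) - F (w (of_real x))) / (Z n - of_real x) = 1" for n
    proof -
      have "Z n \<noteq> of_real x" using Z(1)[of n] by auto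
      then show ?thesis using phi[OF Z(1)] by (simp add: Fwx) (simp add: F_def)
    qed
    ultimately show ?thesis using LIMSEQ_unique[OF _ tendsto_const] by auto
  qed
  from arg_cong[OF this, of Re] have Dw: "D * Re w' = 1" by simp
  have "0 \<le> Re w'"
  proof -
    have "(\<lambda>n. (w (Z n) - w (of_real x)) / (Z n - of_real x)) \<longlonglongrightarrow> w'"
      using w' Z(3) unfolding has_field_derivative_iff by (rule filterlim_compose)
    then have "(\<lambda>n. Re ((w (Z n) - w (of_real x)) / (Z n - of_real x))) \<longlonglongrightarrow> Re w'"
      by (rule tendsto_Re)
    moreover have "0 \<le> Re ((w (Z n) - w (of_real x)) / (Z n - of_real x))" for n
      using imw[OF Z(1), of n] Z(1)[of n] by (simp add: Re_divide wx Z(2))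
    ultimately show ?thesis by (intro LIMSEQ_le_const) auto
  qed
  with Dw have D: "0 < D" by (metis mult_nonpos_nonneg not_le zero_less_one)
  have neg: "p < 0"
  proof (cases "x \<le> 0")
    case True
    then have "0 < T" using t(3) T T0 by simp
    then have "x * c * T \<le> 0" "0 < 1 / (c * T)"
      using c True by (simp_all add: mult_nonpos_nonneg)
    then have "v < 0" unfolding v_def by linarith
    then show ?thesis unfolding p_def by (intro resolvent_mean_negative E lam)
  next
    case False
    show ?thesis
    proof (rule ccontr)
      assume "\<not> p < 0"
      then have T1: "0 < T" using False T0 unfolding p_eq by (smt (verit) mult_pos_neg)
      then have p0: "0 < p" using False by (simp add: p_eq)
      \<comment> \<open>\<open>p\<close> is zero for \<open>v = 0\<close> and negative for \<open>v < 0\<close>.\<close>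
      have "v \<noteq> 0" using p0 resolvent_mean_of_real[of E lam 0] mean_v by (auto simp: complex_eq_iff)
      moreover have "\<not> v < 0" using resolvent_mean_negative[OF E, of lam v] lam p0 by (force simp: p_def)
      ultimately have "0 < v" by simp
      then have "p \<le> v * A" unfolding p_def A_def by (intro resolvent_mean_le_slope lam v)
      then have "D \<le> 2 * (c * p) * (c * A - 1)"
      proof -
        have "c * p \<le> c * (v * A)" using c \<open>p \<le> v * A\<close> by simp
        then show ?thesis by (simp add: D_def algebra_simps)
      qed
      also have "\<dots> \<le> 0" using cA c p0 by (intro mult_nonneg_nonpos) auto
      finally show False using D by simp
    qed
  qed
  show ?thesis
  proof (rule that)
    show "of_real c * resolvent_mean E lam (of_real v) * (of_real c * resolvent_mean E lam (of_real v) - of_real v) = of_real x"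
      using Fwx by (simp add: F_def wx)
    show "((\<lambda>u. of_real c * resolvent_mean E lam u * (of_real c * resolvent_mean E lam u - u)) has_field_derivative
        of_real D) (at (of_real v))"
      using dF by (simp add: F_def[abs_def])
  qed (use wx v D neg p_def in auto)
qed

section \<open>Boundary values of the Stieltjes transform\<close>


lemma Re_stieltjes_nonneg:
  assumes "sets \<mu> = sets borel" "emeasure \<mu> {..<0} = 0" "Re z \<le> 0"
  shows "0 \<le> Re (stieltjes \<mu> z)"
proof (cases "integrable \<mu> (\<lambda>s. 1 / (complex_of_real s - z))")
  case True
  have "{..<0} \<in> null_sets \<mu>" using assms by (simp add: null_sets_def)
  then have "AE s in \<mu>. 0 \<le> s" by (rule AE_I') (auto simp: not_le)
  then have "AE s in \<mu>. 0 \<le> Re (1 / (complex_of_real s - z))"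
    by eventually_elim (use assms(3) in \<open>simp add: Re_divide\<close>)
  then have "0 \<le> (\<integral>s. Re (1 / (complex_of_real s - z)) \<partial>\<mu>)"
    by (rule integral_nonneg_AE)
  also have "\<dots> = Re (stieltjes \<mu> z)"
    unfolding stieltjes_def by (rule integral_Re[OF True])
  finally show ?thesis .
qed (simp add: stieltjes_def not_integrable_integral_eq)

lemma abs_Im_stieltjes_le:
  assumes "finite_measure \<mu>" "0 < d" "AE s in \<mu>. d \<le> \<bar>s - Re z\<bar>"
  shows "\<bar>Im (stieltjes \<mu> z)\<bar> \<le> \<bar>Im z\<bar> / d\<^sup>2 * measure \<mu> (space \<mu>)"
proof (cases "integrable \<mu> (\<lambda>s. 1 / (complex_of_real s - z))")
  case True
  interpret finite_measure \<mu> by fact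
  have int: "integrable \<mu> (\<lambda>s. Im (1 / (complex_of_real s - z)))"
    by (rule integrable_Im[OF True])
  have "\<bar>Im (stieltjes \<mu> z)\<bar> = \<bar>\<integral>s. Im (1 / (complex_of_real s - z)) \<partial>\<mu>\<bar>"
    unfolding stieltjes_def by (simp only: integral_Im[OF True])
  also have "\<dots> \<le> (\<integral>s. \<bar>Im (1 / (complex_of_real s - z))\<bar> \<partial>\<mu>)"
    by (rule integral_abs_bound)
  also have "\<dots> \<le> (\<integral>s. \<bar>Im z\<bar> / d\<^sup>2 \<partial>\<mu>)"
  proof (rule integral_mono_AE)
    show "AE s in \<mu>. \<bar>Im (1 / (complex_of_real s - z))\<bar> \<le> \<bar>Im z\<bar> / d\<^sup>2"
      using assms(3)
    proof eventually_elim
      case (elim s)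
      have "d\<^sup>2 \<le> (s - Re z)\<^sup>2" using elim assms(2) by (simp add: abs_le_square_iff[symmetric])
      then have "d\<^sup>2 \<le> (s - Re z)\<^sup>2 + (Im z)\<^sup>2" by (simp add: add_increasing2)
      moreover have "\<bar>Im (1 / (complex_of_real s - z))\<bar> = \<bar>Im z\<bar> / ((s - Re z)\<^sup>2 + (Im z)\<^sup>2)"
        by (simp add: Im_divide)
      ultimately show ?case using assms(2) by (simp add: divide_left_mono add_pos_nonneg order_less_le_trans[of 0 "d\<^sup>2"])
    qed
  qed (use int in auto)
  also have "\<dots> = \<bar>Im z\<bar> / d\<^sup>2 * measure \<mu> (space \<mu>)" by simp
  finally show ?thesis .
qed (simp add: stieltjes_def not_integrable_integral_eq)

lemma AE_away_from_support:
  assumes "sets \<mu> = sets borel" "x \<notin> measure_support \<mu>"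
  obtains d where "0 < d" "AE s in \<mu>. d \<le> \<bar>s - x\<bar>"
proof -
  obtain U where U: "open U" "x \<in> U" "emeasure \<mu> U = 0"
    using assms(2) by (auto simp: measure_support_def zero_less_iff_neq_zero)
  obtain d where d: "0 < d" "ball x d \<subseteq> U" using U open_contains_ball by blast
  have "U \<in> null_sets \<mu>" using U assms(1) by (simp add: null_sets_def)
  then have "AE s in \<mu>. d \<le> \<bar>s - x\<bar>"
    by (rule AE_I') (use d in \<open>auto simp: subset_eq dist_real_def abs_minus_commute not_le\<close>)
  with d(1) show ?thesis by (rule that)
qed

text \<open>
  Off the support the distance from \<open>x\<close> to the mass of \<open>\<mu>\<close> is positive, so the imaginary part of the
  transform is of the order of \<open>Im z\<close> near \<open>x\<close>.
\<close>

lemma stieltjes_boundary_value: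
  assumes mu: "finite_measure \<mu>" "sets \<mu> = sets borel" "emeasure \<mu> {..<0} = 0"
    and x: "x \<notin> measure_support \<mu>"
    and t: "\<And>z. 0 < Im z \<Longrightarrow> t z = stieltjes \<mu> z" "isCont t (of_real x)"
  shows "t (of_real x) \<in> \<real>" "x \<le> 0 \<Longrightarrow> 0 \<le> Re (t (of_real x))"
proof -
  obtain Z where Z: "\<And>n. 0 < Im (Z n)" "\<And>n. Re (Z n) = x"
    "filterlim Z (at (complex_of_real x)) sequentially"
    using sequence_into_upper_half_plane[of x] by blast
  have Zx: "Z \<longlonglongrightarrow> of_real x" using Z(3) by (simp add: filterlim_at)
  have tZ: "(\<lambda>n. t (Z n)) \<longlonglongrightarrow> t (of_real x)"
    using t(2) Zx by (rule isCont_tendsto_compose)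
  obtain d where d: "0 < d" "AE s in \<mu>. d \<le> \<bar>s - x\<bar>"
    using AE_away_from_support[OF mu(2) x] .
  have "(\<lambda>n. \<bar>Im (Z n)\<bar> / d\<^sup>2 * measure \<mu> (space \<mu>))
      \<longlonglongrightarrow> \<bar>Im (complex_of_real x)\<bar> / d\<^sup>2 * measure \<mu> (space \<mu>)"
    using d by (intro tendsto_intros Zx) auto
  then have lim: "(\<lambda>n. \<bar>Im (Z n)\<bar> / d\<^sup>2 * measure \<mu> (space \<mu>)) \<longlonglongrightarrow> 0" by simp
  have "\<bar>Im (t (Z n))\<bar> \<le> \<bar>Im (Z n)\<bar> / d\<^sup>2 * measure \<mu> (space \<mu>)" for n
    unfolding t(1)[OF Z(1)] using d by (intro abs_Im_stieltjes_le mu(1)) (simp_all add: Z(2))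
  then have "(\<lambda>n. Im (t (Z n))) \<longlonglongrightarrow> 0"
    by (intro Lim_null_comparison[OF _ lim] always_eventually) simp
  then have "Im (t (of_real x)) = 0"
    by (rule LIMSEQ_unique[OF tendsto_Im[OF tZ]])
  then show "t (of_real x) \<in> \<real>" by (simp add: complex_is_Real_iff)
  show "0 \<le> Re (t (of_real x))" if "x \<le> 0"
  proof (rule LIMSEQ_le_const[OF tendsto_Re[OF tZ]])
    have "0 \<le> Re (t (Z n))" for n
      unfolding t(1)[OF Z(1)] using that by (intro Re_stieltjes_nonneg mu(2,3)) (simp add: Z(2))
    then show "\<exists>N. \<forall>n\<ge>N. 0 \<le> Re (t (Z n))" by blast
  qed
qed

section \<open>The image of a real point outside the support\<close>


theorem proposition11:
  fixes R :: "complex^'m^'m"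
    and N L :: nat
    and a b c x :: real
    and t :: "complex \<Rightarrow> complex"
    and \<mu> :: "real measure"
  assumes "1 \<le> N" and "1 \<le> L"
    and "c = real CARD('m) * real L / real N"
    and "0 < a" and "a < b"
    and "hermitian R"
    and "loewner_le (mat (of_real a)) R"
    and "loewner_less R (mat (of_real b))"
    and "finite_measure \<mu>" and "sets \<mu> = sets borel"
    and "emeasure \<mu> {..<0} = 0"
    and "\<And>z. 0 < Im z \<Longrightarrow> canonical_solution c R z (t z)"
    and "\<And>z. 0 < Im z \<Longrightarrow> t z = stieltjes \<mu> z"
    and "t analytic_on - (complex_of_real ` measure_support \<mu>)"
    and "x \<notin> measure_support \<mu>"
  shows "invertible (R - mat (w_fun c t (of_real x)))
    \<and> w_fun c t (of_real x) \<in> \<real>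
    \<and> phi c R (w_fun c t (of_real x)) = of_real x
    \<and> phi c R field_differentiable at (w_fun c t (of_real x))
    \<and> 0 < deriv (phi c R) (w_fun c t (of_real x))
    \<and> w_fun c t (of_real x) * resolvent_trace R (w_fun c t (of_real x)) < 0"
proof -
  have c: "0 < c" using assms(1-3) by simp
  obtain E :: "(complex^'m) set" and lam where E: "finite E" "E \<noteq> {}" "\<And>e. e \<in> E \<Longrightarrow> a \<le> lam e"
    and inv: "\<And>w. w \<notin> of_real ` lam ` E \<Longrightarrow> invertible (R - mat w)"
    and rt: "\<And>w. w \<notin> of_real ` lam ` E \<Longrightarrow>
       resolvent_trace R w = (\<Sum>e\<in>E. of_real (lam e) / (of_real (lam e) - w)) / of_nat (card E)"
    using resolvent_trace_spectral[OF assms(6,7)] by blast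
  have lam: "\<And>e. e \<in> E \<Longrightarrow> 0 < lam e" using E(3) assms(4) by force
  have w_resolvent_trace: "w * resolvent_trace R w = resolvent_mean E lam w" if "w \<notin> of_real ` lam ` E" for w
    by (simp add: rt[OF that] resolvent_mean_def sum_distrib_left mult.commute)
  define F where "F u = of_real c * resolvent_mean E lam u * (of_real c * resolvent_mean E lam u - u)" for u
  have phiF: "phi c R w = F w" if "w \<notin> of_real ` lam ` E" for w
    unfolding phi_def F_def w_resolvent_trace[OF that, symmetric] by (simp add: power2_eq_square algebra_simps)
  have tdiff: "t field_differentiable at (of_real x)"
    by (rule analytic_on_imp_differentiable_at[OF assms(14)]) (use assms(15) in auto)
  note can = canonical_solution_preimage[OF c _ assms(12) w_fun_def[of c t] inv w_resolvent_trace]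
  note tx = stieltjes_boundary_value[OF assms(9-11) assms(15) assms(13)
      field_differentiable_imp_continuous_at[OF tdiff]]
  have tnz: "t z \<noteq> 0" if "0 < Im z" for z
    using assms(12)[OF that] by (auto simp: canonical_solution_def)
  obtain v D where v: "w_fun c t (of_real x) = of_real v" "v \<notin> lam ` E"
    "F (of_real v) = of_real x" "(F has_field_derivative of_real D) (at (of_real v))" "0 < D"
    "Re (resolvent_mean E lam (of_real v)) < 0"
    unfolding F_def[abs_def]
    by (rule real_boundary_point[OF E(1,2) lam c tdiff tx can(1,2) tnz can(3,4)])
  have v': "complex_of_real v \<notin> of_real ` lam ` E" using v(2) by auto
  have "open (- (complex_of_real ` lam ` E))"
    using E(1) by (intro open_Compl finite_imp_closed) auto
  then have der: "(phi c R has_field_derivative of_real D) (at (of_real v))"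
    by (rule has_field_derivative_transform_within_open[OF v(4)]) (use v' phiF in auto)
  have "resolvent_mean E lam (of_real v) < 0"
    using v(6) unfolding resolvent_mean_of_real less_complex_def by simp
  then show ?thesis
    using v(3,5) inv[OF v'] phiF[OF v'] w_resolvent_trace[OF v'] der DERIV_imp_deriv[OF der] unfolding v(1)
    by (auto simp: field_differentiable_def less_complex_def)
qed

end
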